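(* Let $f=f_{a,c}:\mathbb{C}^2\to\mathbb{C}^2$, $f_{a,c}(x,y)=(x^2+c-ay,x)$, $a\neq0$, be a H\'enon mapping with an attracting fixed point $p$, let $\lambda_1\ne\lambda_2$ be the eigenvalues of $D_pf$, and let $\lambda=\max(|\lambda_1|,|\lambda_2|)$. Set $$\tau=\frac{|\lambda_1-\lambda_2|^2}{(2+|\lambda_1|+|\lambda_2|)(2+\lambda^2+|a|)}.$$ Let $\Gamma$ be an $(\varepsilon,\delta)$-box chain recurrent model of $f$, and let $M>1$ satisfy $\delta<\varepsilon/M$. Set $$\kappa=1+\frac1M+\max\{1,\ (1-\lambda)\sqrt{\tau}+2\|p\|+|a|\}.$$ If $$\varepsilon<\tfrac12\left(-\kappa+\sqrt{\kappa^2+\tau(1-\lambda)^2}\right),$$ then $\Gamma$ separates the fixed sink $\{p\}$ from every other chain transitive component of the chain recurrent set $\mathcal{R}$ of $f$.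
   Context: Norm: $\|x\|=\max_k\max\{|\mathrm{Re}\,x_k|,|\mathrm{Im}\,x_k|\}$ for $x\in\mathbb{C}^2$ ($L^\infty$ norm on $\mathbb{R}^4$); $|\cdot|$ is the modulus of a complex number. $\mathcal{N}(S,r)$ is the open $r$-neighborhood of $S$ in the norm $\|\cdot\|$. A closed box is a closed ball of this norm (a closed cube in $\mathbb{R}^4$ with sides parallel to the axes); its side length is its edge length. For bounded $S$, $\mathrm{Hull}(S)$ is the smallest product of four closed intervals in $\mathbb{R}^4=\mathbb{C}^2$ containing $S$. Chain recurrence: an $\varepsilon$-chain of length $n>1$ from $p$ to $q$ is a sequence $p=x_1,\dots,x_n=q$ with $\|f(x_k)-x_{k+1}\|<\varepsilon$ for $1\le k\le n-1$. $\mathcal{R}(\varepsilon)$ is the set of points $p$ admitting an $\varepsilon$-chain from $p$ to $p$, and $\mathcal{R}=\bigcap_{\varepsilon>0}\mathcal{R}(\varepsilon)$. For points of $\mathcal{R}$, write $p\sim q$ if for all $\varepsilon>0$ and all $n\ge1$ there are $\varepsilon$-chains of length greater than $n$ from $p$ to $q$ and from $q$ to $p$; equivalence classes are the chain transitive components of $\mathcal{R}$. Box chain construction for $f$. Step 0: given a closed box $\mathcal{B}_0$ of side length $\varepsilon_0$ and $\delta'_0>0$ with $\mathcal{R}(\delta'_0)\subset\mathcal{B}_0$, choose $\delta_0$ with $\delta'_0<\delta_0<\varepsilon_0$; put $\mathcal{V}_0=\{\mathcal{B}_0\}$. Given the finite collection $\mathcal{V}_n$ of closed boxes, and $\varepsilon_n,\delta_n$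 ($n\ge0$): (i) choose an integer $m>1$ (possibly depending on $n$), set $\varepsilon_{n+1}=\varepsilon_n/m$, and subdivide each box of $\mathcal{V}_n$ into a grid of $m^4$ equal closed boxes, giving a collection $\mathcal{W}_{n+1}$ of boxes of side length $\varepsilon_{n+1}$; (ii) choose $\delta_{n+1}>0$ with $\delta_{n+1}<\delta_n/2$ and $\delta_{n+1}<\varepsilon_{n+1}$ (in practice much smaller, e.g. of the order $\varepsilon_{n+1}/1000$), and let $\Upsilon_{n+1}$ be the directed graph with vertex set $\mathcal{W}_{n+1}$ having an edge from $B$ to $B'$ exactly when $\mathrm{Hull}(f(B))\cap\mathcal{N}(B',\delta_{n+1})\ne\emptyset$; (iii) let $\Gamma_{n+1}$ be the subgraph of $\Upsilon_{n+1}$ consisting precisely of the vertices and edges lying in directed cycles (loops included), $\mathcal{V}_{n+1}$ its vertex set, and $\mathcal{B}_{n+1}$ the union of the boxes in $\mathcal{V}_{n+1}$. An $(\varepsilon,\delta)$-box chain recurrent model of $f$ is a graph $\Gamma=\Gamma_n$, $n\ge1$, produced in this way with $\varepsilon=\varepsilon_n$, $\delta=\delta_n$. Its box chain transitive components are its strongly connected components; each chain transitive component of $\mathcal{R}$ is contained in the union of the boxes of some box chain transitive component, and is then said to lie in it. $\Gamma$ separates two chain transitive components of $\mathcal{R}$ if they lie in different box chain transitive components of $\Gamma$. *)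

theory Defs
  imports "Graph_Theory.Digraph_Component" "HOL-Analysis.Analysis"
begin

type_synonym C2 = "complex \<times> complex"

text \<open>
  The norm is the library's \<^const>\<open>infnorm\<close> of the real Euclidean space \<^typ>\<open>C2\<close>, and a
  product of four closed intervals is a \<^const>\<open>cbox\<close> in it.
\<close>

lemma infnorm_C2:
  fixes z :: C2
  shows "infnorm z = max (max \<bar>Re (fst z)\<bar> \<bar>Im (fst z)\<bar>) (max \<bar>Re (snd z)\<bar> \<bar>Im (snd z)\<bar>)"
  by (simp add: infnorm_Max Basis_prod_def Basis_complex_def image_Un inner_prod_def
      inner_complex_def ac_simps)

definition nbhd :: "C2 set \<Rightarrow> real \<Rightarrow> C2 set" where
  "nbhd S r = {z. \<exists>s\<in>S. infnorm (z - s) < r}"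

definition box_hull :: "C2 set \<Rightarrow> C2 set" where
  "box_hull S = \<Inter> {C. (\<exists>u v. C = cbox u v) \<and> S \<subseteq> C}"

definition henon :: "complex \<Rightarrow> complex \<Rightarrow> C2 \<Rightarrow> C2" where
  "henon a c = (\<lambda>(x, y). (x\<^sup>2 + c - a * y, x))"

definition eigenvals :: "(C2 \<Rightarrow> C2) \<Rightarrow> complex set" where
  "eigenvals D = {\<mu>. \<exists>v. v \<noteq> 0 \<and> D v = (\<mu> * fst v, \<mu> * snd v)}"

definition attracting_fixed_point :: "(C2 \<Rightarrow> C2) \<Rightarrow> C2 \<Rightarrow> bool" where
  "attracting_fixed_point f p \<longleftrightarrow> f p = p \<and> f differentiable (at p) \<and>
     (\<forall>\<mu>\<in>eigenvals (frechet_derivative f (at p)). cmod \<mu> < 1)"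


section \<open>Chain recurrence\<close>

definition eps_chain :: "(C2 \<Rightarrow> C2) \<Rightarrow> real \<Rightarrow> nat \<Rightarrow> C2 \<Rightarrow> C2 \<Rightarrow> bool" where
  "eps_chain f \<epsilon> n p q \<longleftrightarrow> n > 1 \<and>
     (\<exists>x :: nat \<Rightarrow> C2. x 1 = p \<and> x n = q \<and>
        (\<forall>k\<in>{1..n-1}. infnorm (f (x k) - x (k + 1)) < \<epsilon>))"

definition eps_recurrent :: "(C2 \<Rightarrow> C2) \<Rightarrow> real \<Rightarrow> C2 set" where
  "eps_recurrent f \<epsilon> = {p. \<exists>n. eps_chain f \<epsilon> n p p}"

definition chain_recurrent :: "(C2 \<Rightarrow> C2) \<Rightarrow> C2 set" where
  "chain_recurrent f = (\<Inter>\<epsilon>\<in>{0<..}. eps_recurrent f \<epsilon>)"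

definition chain_equiv :: "(C2 \<Rightarrow> C2) \<Rightarrow> C2 rel" where
  "chain_equiv f = {(p, q). p \<in> chain_recurrent f \<and> q \<in> chain_recurrent f \<and>
     (\<forall>\<epsilon>>0. \<forall>n\<ge>1. (\<exists>m>n. eps_chain f \<epsilon> m p q) \<and> (\<exists>m>n. eps_chain f \<epsilon> m q p))}"

definition chain_components :: "(C2 \<Rightarrow> C2) \<Rightarrow> C2 set set" where
  "chain_components f = chain_recurrent f // chain_equiv f"


section \<open>The box chain construction\<close>

definition closed_box :: "C2 \<Rightarrow> real \<Rightarrow> C2 set" where
  "closed_box c s = {z. infnorm (z - c) \<le> s / 2}"

text \<open>
  Along each of the four real coordinate directions, the centers of the \<open>m\<close> pieces of a box of
  side \<open>s\<close> have offsets \<open>- s / 2 + (j + 1 / 2) * (s / m)\<close>, \<open>j < m\<close>, from the center of that box.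
\<close>

definition subdivide :: "C2 set set \<Rightarrow> real \<Rightarrow> nat \<Rightarrow> C2 set set" where
  "subdivide V s m =
     {closed_box (c + (\<Sum>b\<in>Basis. (- s / 2 + (real (j b) + 1 / 2) * (s / real m)) *\<^sub>R b))
        (s / real m)
      | c (j :: C2 \<Rightarrow> nat). closed_box c s \<in> V \<and> (\<forall>b\<in>Basis. j b < m)}"

definition transition_graph ::
    "(C2 \<Rightarrow> C2) \<Rightarrow> C2 set set \<Rightarrow> real \<Rightarrow> C2 set pair_pre_digraph" where
  "transition_graph f W \<delta> =
     \<lparr> pverts = W,
       parcs = {(B, B'). B \<in> W \<and> B' \<in> W \<and> box_hull (f ` B) \<inter> nbhd B' \<delta> \<noteq> {}} \<rparr>"

text \<open>
  The library's notion of cycle admits loops. Every vertex of a cycle is the tail of one of its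
  arcs.
\<close>

definition cyclic_part :: "'a pair_pre_digraph \<Rightarrow> 'a pair_pre_digraph" where
  "cyclic_part G =
     \<lparr> pverts = {fst e | e w. pre_digraph.cycle (with_proj G) w \<and> e \<in> set w},
       parcs = {e. \<exists>w. pre_digraph.cycle (with_proj G) w \<and> e \<in> set w} \<rparr>"

definition box_step :: "(C2 \<Rightarrow> C2) \<Rightarrow> C2 set set \<Rightarrow> real \<Rightarrow> real
    \<Rightarrow> C2 set pair_pre_digraph \<Rightarrow> real \<Rightarrow> real \<Rightarrow> bool" where
  "box_step f V \<epsilon> \<delta> \<Gamma> \<epsilon>' \<delta>' \<longleftrightarrow>
     (\<exists>m::nat. m > 1 \<and> \<epsilon>' = \<epsilon> / real m \<and> 0 < \<delta>' \<and> \<delta>' < \<delta> / 2 \<and> \<delta>' < \<epsilon>' \<and>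
        \<Gamma> = cyclic_part (transition_graph f (subdivide V \<epsilon> m) \<delta>'))"

text \<open>\<open>box_stage f V \<epsilon> \<delta>\<close>: some run of the construction has \<open>V\<^sub>n = V\<close>, \<open>\<epsilon>\<^sub>n = \<epsilon>\<close>, \<open>\<delta>\<^sub>n = \<delta>\<close> for some \<open>n \<ge> 0\<close>.\<close>

inductive box_stage :: "(C2 \<Rightarrow> C2) \<Rightarrow> C2 set set \<Rightarrow> real \<Rightarrow> real \<Rightarrow> bool" for f where
  init: "0 < \<delta>' \<Longrightarrow> eps_recurrent f \<delta>' \<subseteq> closed_box c \<epsilon> \<Longrightarrow> \<delta>' < \<delta> \<Longrightarrow> \<delta> < \<epsilon> \<Longrightarrow>
           box_stage f {closed_box c \<epsilon>} \<epsilon> \<delta>"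
| step: "box_stage f V \<epsilon> \<delta> \<Longrightarrow> box_step f V \<epsilon> \<delta> \<Gamma> \<epsilon>' \<delta>' \<Longrightarrow>
           box_stage f (pverts \<Gamma>) \<epsilon>' \<delta>'"

definition box_chain_model ::
    "(C2 \<Rightarrow> C2) \<Rightarrow> real \<Rightarrow> real \<Rightarrow> C2 set pair_pre_digraph \<Rightarrow> bool" where
  "box_chain_model f \<epsilon> \<delta> \<Gamma> \<longleftrightarrow>
     (\<exists>V \<epsilon>0 \<delta>0. box_stage f V \<epsilon>0 \<delta>0 \<and> box_step f V \<epsilon>0 \<delta>0 \<Gamma> \<epsilon> \<delta>)"

definition lies_in :: "C2 set \<Rightarrow> (C2 set, C2 set \<times> C2 set) pre_digraph \<Rightarrow> bool" where
  "lies_in T H \<longleftrightarrow> T \<subseteq> \<Union> (verts H)"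

text \<open>
  Separation is a relation between chain transitive components, so both arguments are required
  to be such.
\<close>

definition separates ::
    "(C2 \<Rightarrow> C2) \<Rightarrow> C2 set pair_pre_digraph \<Rightarrow> C2 set \<Rightarrow> C2 set \<Rightarrow> bool" where
  "separates f \<Gamma> T T' \<longleftrightarrow> T \<in> chain_components f \<and> T' \<in> chain_components f \<and>
     (\<exists>H \<in> pre_digraph.sccs (with_proj \<Gamma>). \<exists>H' \<in> pre_digraph.sccs (with_proj \<Gamma>).
        H \<noteq> H' \<and> lies_in T H \<and> lies_in T' H')"

end

theory Submission
  imports Defs
begin

text \<open>
  Write \<open>l1\<close>, \<open>l2\<close> for the eigenvalues at the sink \<open>p\<close>. In coordinates along the eigenvectors
  \<open>(l1, 1)\<close>, \<open>(l2, 1)\<close>, with the larger of the two moduli as norm \<open>N\<close>, the linear part contracts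
  by \<open>lam\<close>, and since the only nonlinear term of a Henon map is the square of the first coordinate,
  \<open>N (f z - p) \<le> lam * N (z - p) + (g * N (z - p))\<^sup>2\<close>, where \<open>g\<close> bounds the first coordinate in
  terms of \<open>N\<close> (\<open>N_henon_le\<close>). Hence the ball of radius \<open>r = (1 - lam) / (2 * g\<^sup>2)\<close> around \<open>p\<close> is
  mapped into itself even after a perturbation of \<open>N\<close>-size up to \<open>(1 - lam)\<^sup>2 / (4 * g\<^sup>2)\<close>.

  One step along an arc of the box graph is such a perturbed step for the centers of the boxes: the
  perturbation comes from half a side of the target box, from \<open>\<delta>\<close>, and from the radius of a box
  around the image of the source box, which also contains the hull. The bound on \<open>\<epsilon>\<close> says that
  \<open>4 * (\<epsilon>\<^sup>2 + \<kappa> * \<epsilon>) < \<tau> * (1 - lam)\<^sup>2\<close>, and \<open>\<tau> \<le> 1 / (4 * g\<^sup>2)\<close> (\<open>four_tau_le\<close>), so that the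
  perturbation is admissible (\<open>center_step\<close>). Therefore every box reachable from a box containing
  the sink stays so close to the sink that the map contracts strictly there, and in such a region
  the sink is the only chain recurrent point (\<open>eq_sink_if_chains\<close>).

  On the combinatorial side, box chains shadow chains with small errors, so that every chain
  transitive component lies in some strong component of the graph (\<open>component_lies_in_scc\<close>). By the
  previous paragraph a component other than \<open>{p}\<close> cannot lie in the one that contains the sink.
\<close>


section \<open>Chains as powers of a relation\<close>

definition pseudo_step :: "(C2 \<Rightarrow> C2) \<Rightarrow> real \<Rightarrow> C2 rel" where
  "pseudo_step f \<epsilon> = {(x, y). infnorm (f x - y) < \<epsilon>}"

lemma eps_chain_iff_relpow:
  "eps_chain f \<epsilon> n p q \<longleftrightarrow> n > 1 \<and> (p, q) \<in> pseudo_step f \<epsilon> ^^ (n - 1)"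
proof (cases "n > 1")
  case True
  have "(\<exists>x :: nat \<Rightarrow> C2. x 1 = p \<and> x n = q \<and>
          (\<forall>k\<in>{1..n-1}. infnorm (f (x k) - x (k + 1)) < \<epsilon>)) \<longleftrightarrow>
        (\<exists>y :: nat \<Rightarrow> C2. y 0 = p \<and> y (n - 1) = q \<and>
          (\<forall>i<n-1. (y i, y (Suc i)) \<in> pseudo_step f \<epsilon>))" (is "?L \<longleftrightarrow> ?R")
  proof
    assume ?L
    then obtain x where "x 1 = p" "x n = q"
      and "\<And>k. k \<in> {1..n-1} \<Longrightarrow> infnorm (f (x k) - x (k + 1)) < \<epsilon>"
      by blast
    then show ?R
      using True by (intro exI[of _ "\<lambda>i. x (Suc i)"]) (auto simp: pseudo_step_def)
  next
    assume ?R
    then obtain y where "y 0 = p" "y (n - 1) = q"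
      and y: "\<And>i. i < n - 1 \<Longrightarrow> (y i, y (Suc i)) \<in> pseudo_step f \<epsilon>"
      by blast
    moreover have "infnorm (f (y (k - 1)) - y (k + 1 - 1)) < \<epsilon>" if "k \<in> {1..n-1}" for k
      using y[of "k - 1"] that True by (auto simp: pseudo_step_def)
    ultimately show ?L
      by (intro exI[of _ "\<lambda>k. y (k - 1)"]) auto
  qed
  then show ?thesis
    using True by (simp add: eps_chain_def relpow_fun_conv)
qed (simp add: eps_chain_def)

lemma eps_chain_imp_trancl: "eps_chain f \<epsilon> n p q \<Longrightarrow> (p, q) \<in> (pseudo_step f \<epsilon>)\<^sup>+"
  by (auto simp: eps_chain_iff_relpow trancl_power intro: exI[of _ "n - 1"])

lemma eps_recurrent_iff_trancl: "p \<in> eps_recurrent f \<epsilon> \<longleftrightarrow> (p, p) \<in> (pseudo_step f \<epsilon>)\<^sup>+"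
proof -
  have "\<exists>n. eps_chain f \<epsilon> n p p" if "(p, p) \<in> pseudo_step f \<epsilon> ^^ k" "k > 0" for k
    using that by (intro exI[of _ "Suc k"]) (simp add: eps_chain_iff_relpow)
  then show ?thesis
    by (auto simp: eps_recurrent_def trancl_power dest: eps_chain_imp_trancl[unfolded trancl_power])
qed

lemma pseudo_step_mono: "\<epsilon> \<le> \<epsilon>' \<Longrightarrow> pseudo_step f \<epsilon> \<subseteq> pseudo_step f \<epsilon>'"
  by (auto simp: pseudo_step_def)

lemma eps_recurrent_mono: "\<epsilon> \<le> \<epsilon>' \<Longrightarrow> eps_recurrent f \<epsilon> \<subseteq> eps_recurrent f \<epsilon>'"
  by (meson eps_recurrent_iff_trancl pseudo_step_mono subsetI trancl_mono)

text \<open>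
  The equivalence asks for arbitrarily long chains; running around one closed chain many times
  provides them.
\<close>

lemma chain_equiv_refl:
  assumes "q \<in> chain_recurrent f"
  shows "(q, q) \<in> chain_equiv f"
proof -
  have "\<exists>m>n. eps_chain f \<epsilon> m q q" if "\<epsilon> > 0" for \<epsilon> :: real and n :: nat
  proof -
    have "(q, q) \<in> (pseudo_step f \<epsilon>)\<^sup>+"
      using assms that by (auto simp: chain_recurrent_def eps_recurrent_iff_trancl)
    then obtain k where k: "k > 0" "(q, q) \<in> pseudo_step f \<epsilon> ^^ k"
      by (auto simp: trancl_power)
    have "(q, q) \<in> pseudo_step f \<epsilon> ^^ (j * k)" for j
      using k(2) by (induction j) (auto simp: relpow_add)
    moreover have "Suc (Suc n * k) > n" "Suc (Suc n * k) > 1"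
      using k(1) by (simp_all add: less_Suc_eq_le trans_le_add2)
    ultimately show ?thesis
      by (intro exI[of _ "Suc (Suc n * k)"]) (simp add: eps_chain_iff_relpow del: mult_Suc)
  qed
  then show ?thesis
    using assms by (auto simp: chain_equiv_def)
qed

lemma chain_equiv_sym: "(p, q) \<in> chain_equiv f \<Longrightarrow> (q, p) \<in> chain_equiv f"
  by (auto simp: chain_equiv_def)

lemma chain_equiv_imp_trancl:
  assumes "(p, q) \<in> chain_equiv f" "\<epsilon> > 0"
  shows "(p, q) \<in> (pseudo_step f \<epsilon>)\<^sup>+"
  using assms eps_chain_imp_trancl unfolding chain_equiv_def by blast

lemma chain_component_imp_trancl:
  assumes "T \<in> chain_components f" "x \<in> T" "y \<in> T" "\<epsilon> > 0"
  shows "(x, y) \<in> (pseudo_step f \<epsilon>)\<^sup>+"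
proof -
  obtain q where "(q, x) \<in> chain_equiv f" "(q, y) \<in> chain_equiv f"
    using assms(1-3) by (auto simp: chain_components_def quotient_def)
  then show ?thesis
    using assms(4) by (meson chain_equiv_imp_trancl chain_equiv_sym trancl_trans)
qed

lemma chain_component_nonempty: "T \<in> chain_components f \<Longrightarrow> T \<noteq> {}"
  using chain_equiv_refl by (auto simp: chain_components_def quotient_def)

lemma fixed_point_chain_recurrent: "f p = p \<Longrightarrow> p \<in> chain_recurrent f"
  by (auto simp: chain_recurrent_def eps_recurrent_iff_trancl pseudo_step_def infnorm_0)


section \<open>Cyclic parts of graphs\<close>

text \<open>
  A path back from the head of an arc to its tail can be shortened to a simple path, which then
  closes up with the arc to a cycle.
\<close>

lemma arcs_cyclic_part:
  assumes "pair_wf_digraph G"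
  shows "parcs (cyclic_part G) = {(u, v) \<in> parcs G. (v, u) \<in> (parcs G)\<^sup>*}"
proof -
  interpret pair_wf_digraph G by fact
  have "e \<in> parcs G \<and> (snd e, fst e) \<in> (parcs G)\<^sup>*" if w: "cycle w" "e \<in> set w" for w e
  proof -
    obtain u where u: "awalk u w u"
      using w(1) unfolding cycle_def by blast
    obtain w1 w2 where "w = w1 @ e # w2"
      using split_list[OF w(2)] by blast
    with u have "awalk u w1 (fst e)" "awalk (snd e) w2 u" "e \<in> parcs G"
      by (auto simp: awalk_Cons_iff)
    then have "u \<rightarrow>\<^sup>*\<^bsub>with_proj G\<^esub> fst e" "snd e \<rightarrow>\<^sup>*\<^bsub>with_proj G\<^esub> u"
      by (auto intro: reachable_awalkI)
    then have "snd e \<rightarrow>\<^sup>*\<^bsub>with_proj G\<^esub> fst e"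
      by (rule reachable_trans[rotated])
    then show ?thesis
      using \<open>e \<in> parcs G\<close> by (auto simp: reachable_conv)
  qed
  moreover have "\<exists>w. cycle w \<and> (u, v) \<in> set w"
    if "(u, v) \<in> parcs G" "(v, u) \<in> (parcs G)\<^sup>*" for u v
  proof -
    have "v \<rightarrow>\<^sup>*\<^bsub>with_proj G\<^esub> u"
      using that in_arcsD1 in_arcsD2 by (auto simp: reachable_conv)
    then obtain q where q: "apath v q u"
      by (auto simp: reachable_apath)
    then have "cycle ((u, v) # q)"
      unfolding cycle_def using that(1) by (intro exI[of _ u]) (auto simp: apath_def awalk_Cons_iff)
    then show ?thesis
      by (intro exI[of _ "(u, v) # q"]) simp
  qed
  ultimately show ?thesis
    by (auto simp: cyclic_part_def)
qed

lemma verts_cyclic_part: "pverts (cyclic_part G) = fst ` parcs (cyclic_part G)"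
  by (auto simp: cyclic_part_def image_def)

lemma pair_wf_digraph_cyclic_part:
  assumes "pair_wf_digraph G"
  shows "pair_wf_digraph (cyclic_part G)"
proof
  fix e assume e: "e \<in> parcs (cyclic_part G)"
  then show "fst e \<in> pverts (cyclic_part G)"
    by (simp add: verts_cyclic_part)
  obtain u v where uv: "e = (u, v)" "(u, v) \<in> parcs G" "(v, u) \<in> (parcs G)\<^sup>*"
    using e by (auto simp: arcs_cyclic_part[OF assms])
  show "snd e \<in> pverts (cyclic_part G)"
    using uv(3)
  proof (cases rule: converse_rtranclE)
    case base
    then show ?thesis
      using e uv(1) by (force simp: verts_cyclic_part)
  next
    case (step w)
    then have "(w, v) \<in> (parcs G)\<^sup>*"
      using uv(2) by (meson rtrancl.rtrancl_into_rtrancl)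
    then have "(v, w) \<in> parcs (cyclic_part G)"
      using step(1) by (auto simp: arcs_cyclic_part[OF assms])
    then show ?thesis
      using uv(1) by (force simp: verts_cyclic_part)
  qed
qed

lemma trancl_cyclic_part:
  assumes "pair_wf_digraph G" "(u, v) \<in> (parcs G)\<^sup>+" "(v, u) \<in> (parcs G)\<^sup>*"
  shows "(u, v) \<in> (parcs (cyclic_part G))\<^sup>+"
  using assms(2,3)
proof (induction rule: trancl_induct)
  case (base y)
  then show ?case
    by (auto simp: arcs_cyclic_part[OF assms(1)])
next
  case (step y z)
  have "(u, y) \<in> (parcs (cyclic_part G))\<^sup>+"
    using step by (meson converse_rtrancl_into_rtrancl)
  moreover have "(z, y) \<in> (parcs G)\<^sup>*"
    using step.hyps(1) step.prems by (meson rtrancl_trans trancl_into_rtrancl)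
  then have "(y, z) \<in> parcs (cyclic_part G)"
    using step.hyps(2) by (auto simp: arcs_cyclic_part[OF assms(1)])
  ultimately show ?case
    by (rule trancl_into_trancl)
qed


section \<open>Boxes\<close>

lemma infnorm_le_iff: "infnorm (z :: C2) \<le> r \<longleftrightarrow> (\<forall>b\<in>Basis. \<bar>z \<bullet> b\<bar> \<le> r)"
  by (simp add: infnorm_Max)

lemma closed_box_eq_cbox:
  "closed_box c s = cbox (c - (s / 2) *\<^sub>R One) (c + (s / 2) *\<^sub>R One)"
proof -
  have "\<bar>(z - c) \<bullet> b\<bar> \<le> s / 2 \<longleftrightarrow>
      (c - (s / 2) *\<^sub>R One) \<bullet> b \<le> z \<bullet> b \<and> z \<bullet> b \<le> (c + (s / 2) *\<^sub>R One) \<bullet> b"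
    if "b \<in> Basis" for z b :: C2
  proof -
    have "(c - (s / 2) *\<^sub>R One) \<bullet> b = c \<bullet> b - s / 2" "(c + (s / 2) *\<^sub>R One) \<bullet> b = c \<bullet> b + s / 2"
      using that by (simp_all add: inner_diff_left inner_add_left)
    then show ?thesis
      unfolding inner_diff_left abs_le_iff by linarith
  qed
  then show ?thesis
    unfolding closed_box_def set_eq_iff mem_Collect_eq infnorm_le_iff mem_box by blast
qed

lemma box_hull_subset_closed_box: "S \<subseteq> closed_box c s \<Longrightarrow> box_hull S \<subseteq> closed_box c s"
  unfolding box_hull_def closed_box_eq_cbox by blast

lemma subset_box_hull: "S \<subseteq> box_hull S"
  by (auto simp: box_hull_def)

lemma unit_interval_around:
  fixes t :: real
  assumes "0 \<le> t" "t \<le> real m" "m > 0"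
  shows "\<exists>j<m. \<bar>t - (real j + 1 / 2)\<bar> \<le> 1 / 2"
proof (cases "t = real m")
  case True
  then show ?thesis
    using assms by (intro exI[of _ "m - 1"]) auto
next
  case False
  then have "nat \<lfloor>t\<rfloor> < m"
    using assms by (simp add: nat_less_iff floor_less_iff)
  moreover have "\<bar>t - (real (nat \<lfloor>t\<rfloor>) + 1 / 2)\<bar> \<le> 1 / 2"
    using assms by (simp add: abs_if) linarith
  ultimately show ?thesis
    by blast
qed

lemma Union_subset_Union_subdivide:
  assumes V: "\<And>B. B \<in> V \<Longrightarrow> \<exists>c. B = closed_box c s" and "s > 0" "m > 0"
  shows "\<Union> V \<subseteq> \<Union> (subdivide V s m)"
proof
  fix z assume "z \<in> \<Union> V"
  then obtain c where c: "closed_box c s \<in> V" "z \<in> closed_box c s"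
    using V by blast
  have "\<exists>j<m. \<bar>(z - c) \<bullet> b - (- s / 2 + (real j + 1 / 2) * (s / real m))\<bar> \<le> s / real m / 2"
    if b: "b \<in> Basis" for b
  proof -
    let ?t = "((z - c) \<bullet> b + s / 2) / (s / real m)"
    have "\<bar>(z - c) \<bullet> b\<bar> \<le> s / 2"
      using c(2) b unfolding closed_box_def mem_Collect_eq infnorm_le_iff by blast
    then have "0 \<le> (z - c) \<bullet> b + s / 2" "(z - c) \<bullet> b + s / 2 \<le> s"
      by (auto simp: abs_le_iff)
    then have "0 \<le> ?t" "?t \<le> real m"
      using assms(2,3) by (auto simp: divide_simps mult.commute)
    then obtain j where j: "j < m" "\<bar>?t - (real j + 1 / 2)\<bar> \<le> 1 / 2"
      using unit_interval_around[OF _ _ assms(3)] by blast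
    have "(z - c) \<bullet> b - (- s / 2 + (real j + 1 / 2) * (s / real m)) =
        (?t - (real j + 1 / 2)) * (s / real m)"
      using assms(2,3) by (simp add: field_simps)
    also have "\<bar>\<dots>\<bar> \<le> 1 / 2 * (s / real m)"
      unfolding abs_mult using j(2) assms(2,3) by (intro mult_mono) auto
    finally show ?thesis
      using j(1) by (auto intro!: exI[of _ j])
  qed
  then obtain j where j: "\<And>b. b \<in> Basis \<Longrightarrow> j b < m"
    "\<And>b. b \<in> Basis \<Longrightarrow>
      \<bar>(z - c) \<bullet> b - (- s / 2 + (real (j b) + 1 / 2) * (s / real m))\<bar> \<le> s / real m / 2"
    by metis
  let ?d = "\<Sum>b\<in>Basis. (- s / 2 + (real (j b) + 1 / 2) * (s / real m)) *\<^sub>R (b :: C2)"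
  have "z \<in> closed_box (c + ?d) (s / real m)"
    unfolding closed_box_def mem_Collect_eq infnorm_le_iff
  proof
    fix b :: C2 assume b: "b \<in> Basis"
    have "(z - (c + ?d)) \<bullet> b = (z - c) \<bullet> b - (- s / 2 + (real (j b) + 1 / 2) * (s / real m))"
      using b by (simp add: inner_diff_left inner_add_left)
    then show "\<bar>(z - (c + ?d)) \<bullet> b\<bar> \<le> s / real m / 2"
      using j(2)[OF b] by simp
  qed
  moreover have "closed_box (c + ?d) (s / real m) \<in> subdivide V s m"
    unfolding subdivide_def using c(1) j(1) by blast
  ultimately show "z \<in> \<Union> (subdivide V s m)"
    by blast
qed


section \<open>Box chains shadow chains\<close>

lemma pair_wf_digraph_transition_graph: "pair_wf_digraph (transition_graph f W \<delta>)"
  by unfold_locales (auto simp: transition_graph_def)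

text \<open>
  All points of a closed \<open>\<eta>\<close>-chain are \<open>\<eta>\<close>-recurrent, hence lie in boxes, and two boxes that
  contain consecutive points of the chain are joined by an arc.
\<close>

lemma trancl_transition_graph:
  assumes cover: "eps_recurrent f \<eta> \<subseteq> \<Union> W" and "\<eta> \<le> \<delta>"
    and "(x, y) \<in> (pseudo_step f \<eta>)\<^sup>+" "(y, x) \<in> (pseudo_step f \<eta>)\<^sup>*"
    and "B \<in> W" "x \<in> B" "B' \<in> W" "y \<in> B'"
  shows "(B, B') \<in> (parcs (transition_graph f W \<delta>))\<^sup>+"
proof -
  have arc: "(B, B') \<in> parcs (transition_graph f W \<delta>)"
    if "(x, y) \<in> pseudo_step f \<eta>" "B \<in> W" "x \<in> B" "B' \<in> W" "y \<in> B'" for x y B B'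
  proof -
    have "f x \<in> box_hull (f ` B)"
      using subset_box_hull that(3) by blast
    moreover have "f x \<in> nbhd B' \<delta>"
      using that(1,5) assms(2) by (force simp: nbhd_def pseudo_step_def)
    ultimately show ?thesis
      using that by (auto simp: transition_graph_def)
  qed
  show ?thesis
    using assms(3-)
  proof (induction arbitrary: B' rule: trancl_induct)
    case (base y)
    then show ?case
      using arc by blast
  next
    case (step y z)
    have yx: "(y, x) \<in> (pseudo_step f \<eta>)\<^sup>*"
      using step.hyps(2) step.prems(1) by (rule converse_rtrancl_into_rtrancl)
    then have "(y, y) \<in> (pseudo_step f \<eta>)\<^sup>+"
      using step.hyps(1) by (rule rtrancl_trancl_trancl)
    then obtain C where C: "C \<in> W" "y \<in> C"
      using cover by (auto simp: eps_recurrent_iff_trancl)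
    show ?case
      using step.IH[OF yx step.prems(2,3) C] arc[OF step.hyps(2) C step.prems(4,5)]
      by (rule trancl_into_trancl)
  qed
qed

lemma eps_recurrent_subset_cyclic_part:
  assumes "eps_recurrent f \<eta> \<subseteq> \<Union> W" "\<eta> \<le> \<delta>" "B \<in> W" "x \<in> B" "x \<in> eps_recurrent f \<eta>"
  shows "B \<in> pverts (cyclic_part (transition_graph f W \<delta>))"
proof -
  have "(B, B) \<in> (parcs (transition_graph f W \<delta>))\<^sup>+"
    using assms by (intro trancl_transition_graph[of f \<eta> W \<delta> x x])
      (auto simp: eps_recurrent_iff_trancl)
  then have "(B, B) \<in> (parcs (cyclic_part (transition_graph f W \<delta>)))\<^sup>+"
    by (intro trancl_cyclic_part pair_wf_digraph_transition_graph) auto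
  then show ?thesis
    by (force simp: verts_cyclic_part dest: tranclD)
qed

lemma subdivide_boxes: "B \<in> subdivide V s m \<Longrightarrow> \<exists>c. B = closed_box c (s / real m)"
  unfolding subdivide_def by blast

lemma verts_cyclic_transition_subset:
  "pverts (cyclic_part (transition_graph f W \<delta>)) \<subseteq> W"
  unfolding verts_cyclic_part arcs_cyclic_part[OF pair_wf_digraph_transition_graph]
  by (auto simp: transition_graph_def)

text \<open>
  Chains are shadowed by box chains of a stage once their errors are at most the \<open>\<delta>\<close> of that stage,
  so the threshold \<open>\<eta>\<close> below which all recurrent points are covered shrinks from stage to stage.
\<close>

lemma box_stage_invariants:
  assumes "box_stage f V \<epsilon> \<delta>"
  shows "0 < \<epsilon> \<and> 0 < \<delta> \<and> (\<forall>B\<in>V. \<exists>c. B = closed_box c \<epsilon>) \<and> (\<exists>\<eta>>0. eps_recurrent f \<eta> \<subseteq> \<Union> V)"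
  using assms
proof induction
  case (init \<delta>' c \<epsilon> \<delta>)
  then have "0 < \<epsilon>" "0 < \<delta>"
    by linarith+
  with init.hyps(1,2) show ?case by blast
next
  case (step V \<epsilon> \<delta> \<Gamma> \<epsilon>' \<delta>')
  from step.hyps(2) obtain m :: nat where m: "m > 1" "\<epsilon>' = \<epsilon> / real m" "0 < \<delta>'"
    and \<Gamma>: "\<Gamma> = cyclic_part (transition_graph f (subdivide V \<epsilon> m) \<delta>')"
    unfolding box_step_def by blast
  from step.IH obtain \<eta> where \<eta>: "\<eta> > 0" "eps_recurrent f \<eta> \<subseteq> \<Union> V"
    by blast
  have "\<Union> V \<subseteq> \<Union> (subdivide V \<epsilon> m)"
    using step.IH m(1) by (intro Union_subset_Union_subdivide) auto
  then have cover: "eps_recurrent f (min \<eta> \<delta>') \<subseteq> \<Union> (subdivide V \<epsilon> m)"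
    using \<eta>(2) eps_recurrent_mono[of "min \<eta> \<delta>'" \<eta> f] by auto
  have "eps_recurrent f (min \<eta> \<delta>') \<subseteq> \<Union> (pverts \<Gamma>)"
  proof
    fix x assume x: "x \<in> eps_recurrent f (min \<eta> \<delta>')"
    then obtain B where "B \<in> subdivide V \<epsilon> m" "x \<in> B"
      using cover by blast
    then show "x \<in> \<Union> (pverts \<Gamma>)"
      using eps_recurrent_subset_cyclic_part[OF cover _ _ _ x, of \<delta>' B] unfolding \<Gamma> by auto
  qed
  moreover have "0 < min \<eta> \<delta>'"
    using \<eta>(1) m(3) by simp
  moreover have "\<forall>B\<in>pverts \<Gamma>. \<exists>c. B = closed_box c \<epsilon>'"
    using verts_cyclic_transition_subset subdivide_boxes m(2) unfolding \<Gamma> by blast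
  ultimately show ?case
    using step.IH m by (intro conjI exI[of _ "min \<eta> \<delta>'"]) auto
qed

lemma box_chain_modelE:
  assumes "box_chain_model f \<epsilon> \<delta> \<Gamma>"
  obtains W \<eta> where "0 < \<epsilon>" "0 < \<delta>" "0 < \<eta>" "\<eta> \<le> \<delta>"
    "\<And>B. B \<in> W \<Longrightarrow> \<exists>c. B = closed_box c \<epsilon>" "eps_recurrent f \<eta> \<subseteq> \<Union> W"
    "\<Gamma> = cyclic_part (transition_graph f W \<delta>)"
proof -
  obtain V \<epsilon>0 \<delta>0 where *: "box_stage f V \<epsilon>0 \<delta>0" "box_step f V \<epsilon>0 \<delta>0 \<Gamma> \<epsilon> \<delta>"
    using assms by (auto simp: box_chain_model_def)
  from *(2) obtain m :: nat where m: "m > 1" "\<epsilon> = \<epsilon>0 / real m" "0 < \<delta>"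
    and \<Gamma>: "\<Gamma> = cyclic_part (transition_graph f (subdivide V \<epsilon>0 m) \<delta>)"
    unfolding box_step_def by blast
  obtain \<eta> where \<eta>: "\<eta> > 0" "eps_recurrent f \<eta> \<subseteq> \<Union> V" and V: "0 < \<epsilon>0"
    "\<forall>B\<in>V. \<exists>c. B = closed_box c \<epsilon>0"
    using box_stage_invariants[OF *(1)] by blast
  have "\<Union> V \<subseteq> \<Union> (subdivide V \<epsilon>0 m)"
    using V m(1) by (intro Union_subset_Union_subdivide) auto
  then have "eps_recurrent f (min \<eta> \<delta>) \<subseteq> \<Union> (subdivide V \<epsilon>0 m)"
    using \<eta>(2) eps_recurrent_mono[of "min \<eta> \<delta>" \<eta> f] by auto
  then show thesis
    using m \<Gamma> \<eta>(1) V subdivide_boxes[of _ V \<epsilon>0 m]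
    by (intro that[of "min \<eta> \<delta>" "subdivide V \<epsilon>0 m"]) auto
qed

text \<open>
  Chains from a point \<open>q\<close> of the component to any other of its points and back are shadowed by box
  chains, so the component lies in the strong component of any box that contains \<open>q\<close>.
\<close>

lemma component_lies_in_scc:
  assumes "box_chain_model f \<epsilon> \<delta> \<Gamma>" "T \<in> chain_components f"
  shows "\<exists>H \<in> pre_digraph.sccs (with_proj \<Gamma>). lies_in T H"
proof -
  obtain W \<eta> where W: "0 < \<eta>" "\<eta> \<le> \<delta>" "eps_recurrent f \<eta> \<subseteq> \<Union> W"
    and \<Gamma>: "\<Gamma> = cyclic_part (transition_graph f W \<delta>)"
    using box_chain_modelE[OF assms(1)] by metis
  let ?U = "transition_graph f W \<delta>"
  note wfU = pair_wf_digraph_transition_graph[of f W \<delta>]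
  interpret pair_wf_digraph \<Gamma>
    unfolding \<Gamma> by (rule pair_wf_digraph_cyclic_part[OF wfU])
  have rec: "x \<in> eps_recurrent f \<eta>" if "x \<in> T" for x
    using chain_component_imp_trancl[OF assms(2) that that W(1)]
    by (simp add: eps_recurrent_iff_trancl)
  obtain q where q: "q \<in> T"
    using chain_component_nonempty[OF assms(2)] by blast
  then obtain B where B: "B \<in> W" "q \<in> B"
    using rec W(3) by blast
  have B\<Gamma>: "B \<in> pverts \<Gamma>"
    unfolding \<Gamma> by (rule eps_recurrent_subset_cyclic_part[OF W(3,2) B rec[OF q]])
  have "x \<in> \<Union> (scc_of B)" if x: "x \<in> T" for x
  proof -
    obtain C where C: "C \<in> W" "x \<in> C"
      using rec[OF x] W(3) by blast
    have steps: "(q, x) \<in> (pseudo_step f \<eta>)\<^sup>+" "(x, q) \<in> (pseudo_step f \<eta>)\<^sup>+"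
      using chain_component_imp_trancl[OF assms(2)] q x W(1) by auto
    have BC: "(B, C) \<in> (parcs ?U)\<^sup>+" "(C, B) \<in> (parcs ?U)\<^sup>+"
      using trancl_transition_graph[OF W(3,2) steps(1) trancl_into_rtrancl[OF steps(2)] B C]
        trancl_transition_graph[OF W(3,2) steps(2) trancl_into_rtrancl[OF steps(1)] C B] by simp_all
    then have "(B, C) \<in> (parcs \<Gamma>)\<^sup>+" "(C, B) \<in> (parcs \<Gamma>)\<^sup>+"
      unfolding \<Gamma> using trancl_cyclic_part[OF wfU] trancl_into_rtrancl by metis+
    then show ?thesis
      using C(2) by (auto simp: scc_of_def intro!: bexI[of _ C])
  qed
  moreover have "with_proj \<Gamma> \<restriction> scc_of B \<in> sccs"
    using scc_of_in_sccs_verts[OF B\<Gamma>] in_sccs_verts_conv by blast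
  ultimately show ?thesis
    by (intro bexI[of _ "with_proj \<Gamma> \<restriction> scc_of B"]) (auto simp: lies_in_def)
qed

lemma scc_imp_rtrancl:
  assumes "box_chain_model f \<epsilon> \<delta> \<Gamma>" "H \<in> pre_digraph.sccs (with_proj \<Gamma>)"
    and "B \<in> verts H" "B' \<in> verts H"
  shows "(B, B') \<in> (parcs \<Gamma>)\<^sup>*"
proof -
  obtain W where \<Gamma>: "\<Gamma> = cyclic_part (transition_graph f W \<delta>)"
    using box_chain_modelE[OF assms(1)] by metis
  interpret pair_wf_digraph \<Gamma>
    unfolding \<Gamma> by (rule pair_wf_digraph_cyclic_part[OF pair_wf_digraph_transition_graph])
  have "verts H \<in> sccs_verts"
    using assms(2) by (intro in_sccs_vertsI_sccs) blast
  then have "B \<rightarrow>\<^sup>*\<^bsub>with_proj \<Gamma>\<^esub> B'"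
    using assms(3,4) by (auto simp: sccs_verts_def)
  then show ?thesis
    by (auto simp: reachable_conv)
qed


section \<open>Comparison of the modulus with the box norm\<close>

text \<open>The constant \<open>3 / 2\<close> is a rational upper bound for \<open>sqrt 2\<close>.\<close>

lemma cmod_le_max_Re_Im: "cmod z \<le> 3 / 2 * max \<bar>Re z\<bar> \<bar>Im z\<bar>"
proof -
  let ?m = "max \<bar>Re z\<bar> \<bar>Im z\<bar>"
  have "(cmod z)\<^sup>2 = \<bar>Re z\<bar>\<^sup>2 + \<bar>Im z\<bar>\<^sup>2"
    by (simp add: cmod_power2)
  also have "\<dots> \<le> ?m\<^sup>2 + ?m\<^sup>2"
    by (intro add_mono power_mono) auto
  also have "\<dots> \<le> (3 / 2 * ?m)\<^sup>2"
    by (simp add: power_mult_distrib power2_eq_square)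
  finally show ?thesis
    by (rule power2_le_imp_le) auto
qed

lemma cmod_fst_le_infnorm: "cmod (fst z) \<le> 3 / 2 * infnorm (z :: C2)"
  and cmod_snd_le_infnorm: "cmod (snd z) \<le> 3 / 2 * infnorm (z :: C2)"
  using cmod_le_max_Re_Im[of "fst z"] cmod_le_max_Re_Im[of "snd z"] unfolding infnorm_C2
  by (auto elim!: order_trans intro!: mult_left_mono)

lemma infnorm_triangle_sub:
  "infnorm (x - z) \<le> infnorm (x - y) + infnorm (y - z :: 'a::euclidean_space)"
  using infnorm_triangle[of "x - y" "y - z"] by simp


section \<open>The linear part at the fixed point\<close>

lemma henon_has_derivative:
  "(henon a c has_derivative (\<lambda>h. (2 * fst z * fst h - a * snd h, fst h))) (at z)"
proof -
  have "henon a c = (\<lambda>z. ((fst z)\<^sup>2 + c - a * snd z, fst z))"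
    by (auto simp: henon_def)
  then show ?thesis
    by (auto intro!: derivative_eq_intros)
qed

lemma frechet_derivative_henon:
  "frechet_derivative (henon a c) (at z) = (\<lambda>h. (2 * fst z * fst h - a * snd h, fst h))"
  by (rule frechet_derivative_at[OF henon_has_derivative, symmetric])

text \<open>An eigenvector for \<open>\<mu>\<close> is a multiple of \<open>(\<mu>, 1)\<close>.\<close>

lemma eigenvals_henon_iff:
  "\<mu> \<in> eigenvals (frechet_derivative (henon a c) (at z)) \<longleftrightarrow> \<mu>\<^sup>2 - 2 * fst z * \<mu> + a = 0"
proof
  assume "\<mu> \<in> eigenvals (frechet_derivative (henon a c) (at z))"
  then obtain h k where v: "(h, k) \<noteq> 0" "2 * fst z * h - a * k = \<mu> * h" "h = \<mu> * k"
    by (auto simp: eigenvals_def frechet_derivative_henon)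
  then have "k \<noteq> 0" "(\<mu>\<^sup>2 - 2 * fst z * \<mu> + a) * k = 0"
    by (auto simp: zero_prod_def algebra_simps power2_eq_square)
  then show "\<mu>\<^sup>2 - 2 * fst z * \<mu> + a = 0"
    by simp
next
  assume "\<mu>\<^sup>2 - 2 * fst z * \<mu> + a = 0"
  then have "2 * fst z * \<mu> - a = \<mu> * \<mu>"
    by (simp add: algebra_simps power2_eq_square)
  then have "(\<mu>, 1) \<noteq> (0 :: C2) \<and>
      frechet_derivative (henon a c) (at z) (\<mu>, 1) = (\<mu> * fst (\<mu>, 1), \<mu> * snd (\<mu>, 1))"
    by (simp add: frechet_derivative_henon zero_prod_def)
  then show "\<mu> \<in> eigenvals (frechet_derivative (henon a c) (at z))"
    unfolding eigenvals_def mem_Collect_eq by (rule exI[of _ "(\<mu>, 1)"])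
qed

lemma eigenvals_henon_vieta:
  assumes "eigenvals (frechet_derivative (henon a c) (at z)) = {l1, l2}" "l1 \<noteq> l2"
  shows "l1 + l2 = 2 * fst z" "l1 * l2 = a"
proof -
  have 1: "l1\<^sup>2 - 2 * fst z * l1 + a = 0" and 2: "l2\<^sup>2 - 2 * fst z * l2 + a = 0"
    using assms(1) eigenvals_henon_iff by blast+
  then have "(l1 - l2) * (l1 + l2 - 2 * fst z) = 0"
    by algebra
  then show sum: "l1 + l2 = 2 * fst z"
    using assms(2) by simp
  show "l1 * l2 = a"
    using 1 unfolding sum[symmetric] by algebra
qed

text \<open>
  Up to the factors \<open>l1 - l2\<close> and \<open>l2 - l1\<close>, the two entries are the coordinates of \<open>w\<close> in the basis
  \<open>(l1, 1)\<close>, \<open>(l2, 1)\<close> of eigenvectors.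
\<close>

definition eigen_norm :: "complex \<Rightarrow> complex \<Rightarrow> C2 \<Rightarrow> real" where
  "eigen_norm l1 l2 w = max (cmod (fst w - l2 * snd w)) (cmod (fst w - l1 * snd w))"

lemma eigen_norm_nonneg: "0 \<le> eigen_norm l1 l2 w"
  by (simp add: eigen_norm_def le_max_iff_disj)

lemma eigen_norm_triangle: "eigen_norm l1 l2 (v + w) \<le> eigen_norm l1 l2 v + eigen_norm l1 l2 w"
proof -
  have "cmod (fst (v + w) - l * snd (v + w)) \<le> eigen_norm l1 l2 v + eigen_norm l1 l2 w"
    if l: "l = l1 \<or> l = l2" for l
  proof -
    have "cmod (fst (v + w) - l * snd (v + w)) \<le> cmod (fst v - l * snd v) + cmod (fst w - l * snd w)"
      using norm_triangle_ineq[of "fst v - l * snd v" "fst w - l * snd w"]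
      by (simp add: algebra_simps)
    also have "\<dots> \<le> eigen_norm l1 l2 v + eigen_norm l1 l2 w"
      using l by (intro add_mono) (auto simp: eigen_norm_def)
    finally show ?thesis .
  qed
  then show ?thesis
    by (simp add: eigen_norm_def[of _ _ "v + w"])
qed

lemma eigen_norm_le_infnorm:
  assumes "cmod l1 \<le> 1" "cmod l2 \<le> 1"
  shows "eigen_norm l1 l2 w \<le> 3 * infnorm w"
proof -
  have "cmod (fst w - l * snd w) \<le> 3 * infnorm w" if "cmod l \<le> 1" for l
  proof -
    have "cmod (fst w - l * snd w) \<le> cmod (fst w) + cmod l * cmod (snd w)"
      using norm_triangle_ineq4[of "fst w" "l * snd w"] by (simp add: norm_mult)
    also have "\<dots> \<le> cmod (fst w) + cmod (snd w)"
      using that by (simp add: mult_left_le_one_le)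
    finally show ?thesis
      using cmod_fst_le_infnorm[of w] cmod_snd_le_infnorm[of w] by linarith
  qed
  with assms show ?thesis
    by (simp add: eigen_norm_def)
qed

lemma cmod_fst_le_eigen_norm:
  assumes "l1 \<noteq> l2"
  shows "cmod (fst w) \<le> (cmod l1 + cmod l2) / cmod (l1 - l2) * eigen_norm l1 l2 w"
proof -
  let ?N = "eigen_norm l1 l2 w"
  have "fst w * (l1 - l2) = l1 * (fst w - l2 * snd w) - l2 * (fst w - l1 * snd w)"
    by (simp add: algebra_simps)
  then have "cmod (fst w) * cmod (l1 - l2) =
      cmod (l1 * (fst w - l2 * snd w) - l2 * (fst w - l1 * snd w))"
    by (metis norm_mult)
  also have "\<dots> \<le> cmod l1 * cmod (fst w - l2 * snd w) + cmod l2 * cmod (fst w - l1 * snd w)"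
    using norm_triangle_ineq4[of "l1 * (fst w - l2 * snd w)" "l2 * (fst w - l1 * snd w)"]
    by (simp add: norm_mult)
  also have "\<dots> \<le> cmod l1 * ?N + cmod l2 * ?N"
    by (intro add_mono mult_left_mono) (auto simp: eigen_norm_def)
  finally show ?thesis
    using assms by (simp add: field_simps)
qed

lemma eigen_norm_eq_0:
  assumes "l1 \<noteq> l2" "eigen_norm l1 l2 w \<le> 0"
  shows "w = 0"
proof -
  have "fst w = l2 * snd w" "fst w = l1 * snd w"
    using assms(2) by (auto simp: eigen_norm_def)
  with assms(1) show ?thesis
    by (auto simp: prod_eq_iff)
qed


section \<open>Contraction near the sink\<close>

locale henon_sink =
  fixes a c l1 l2 :: complex and p :: C2 and lam :: real
  assumes fixed: "henon a c p = p"
    and distinct: "l1 \<noteq> l2"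
    and sum_eigenvalues: "l1 + l2 = 2 * fst p"
    and prod_eigenvalues: "l1 * l2 = a"
    and lam_eq: "lam = max (cmod l1) (cmod l2)"
    and lam_less_1: "lam < 1"
begin

abbreviation f :: "C2 \<Rightarrow> C2" where "f \<equiv> henon a c"

abbreviation N :: "C2 \<Rightarrow> real" where "N \<equiv> eigen_norm l1 l2"

text \<open>This is the norm of the functional \<^term>\<open>fst\<close> with respect to \<open>N\<close>.\<close>

definition g :: real where "g = (cmod l1 + cmod l2) / cmod (l1 - l2)"

lemma cmod_eigenvalues: "cmod l1 \<le> lam" "cmod l2 \<le> lam" "cmod l1 \<le> 1" "cmod l2 \<le> 1" "0 \<le> lam"
  using lam_less_1 norm_ge_zero[of l1] by (auto simp: lam_eq le_max_iff_disj)

lemma g_ge_1: "g \<ge> 1"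
  using norm_triangle_ineq4[of l1 l2] distinct by (simp add: g_def)

lemma cmod_fst_le_g: "cmod (fst w) \<le> g * N w"
  using cmod_fst_le_eigen_norm[OF distinct] by (simp add: g_def)

lemma N_le_infnorm: "N w \<le> 3 * infnorm w"
  using eigen_norm_le_infnorm cmod_eigenvalues by blast

text \<open>
  In the coordinates centered at \<open>p\<close> the map is \<open>(u, v) \<mapsto> (2 * fst p * u - a * v + u\<^sup>2, u)\<close>.
  Its linear part multiplies the two entries of the norm by \<open>l1\<close> and \<open>l2\<close>, and the square enters
  both of them additively.
\<close>

lemma N_henon_le: "N (f z - p) \<le> lam * N (z - p) + (g * N (z - p))\<^sup>2"
proof -
  define u v where "u = fst (z - p)" and "v = snd (z - p)"
  let ?N = "N (z - p)"
  have p: "(fst p)\<^sup>2 + c - a * snd p = fst p" "fst p = snd p"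
    using fixed by (auto simp: henon_def split_beta prod_eq_iff)
  have fst_f: "fst (f z - p) = (l1 + l2) * u - l1 * l2 * v + u\<^sup>2"
  proof -
    have "fst (f z - p) = (fst z)\<^sup>2 + c - a * snd z - ((fst p)\<^sup>2 + c - a * snd p)"
      using p(1) by (simp add: henon_def split_beta)
    also have "\<dots> = 2 * fst p * u - a * v + u\<^sup>2"
      by (simp add: u_def v_def power2_eq_square algebra_simps)
    finally show ?thesis
      by (simp add: sum_eigenvalues prod_eigenvalues)
  qed
  have snd_f: "snd (f z - p) = u"
    using p(2) by (simp add: henon_def split_beta u_def)
  have "cmod u ^ 2 \<le> (g * ?N)\<^sup>2"
    using cmod_fst_le_g[of "z - p"] by (intro power_mono) (auto simp: u_def)
  then have quad: "cmod (u\<^sup>2) \<le> (g * ?N)\<^sup>2"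
    by (simp add: norm_power)
  have entry: "cmod (l * (u - l' * v) + u\<^sup>2) \<le> lam * ?N + (g * ?N)\<^sup>2"
    if "cmod l \<le> lam" "cmod (u - l' * v) \<le> ?N" for l l'
  proof -
    have "cmod (l * (u - l' * v)) \<le> lam * ?N"
      unfolding norm_mult using that cmod_eigenvalues(5) by (intro mult_mono) auto
    then show ?thesis
      using quad norm_triangle_ineq[of "l * (u - l' * v)" "u\<^sup>2"] by linarith
  qed
  have "fst (f z - p) - l2 * snd (f z - p) = l1 * (u - l2 * v) + u\<^sup>2"
    "fst (f z - p) - l1 * snd (f z - p) = l2 * (u - l1 * v) + u\<^sup>2"
    unfolding fst_f snd_f by (simp_all add: algebra_simps)
  then show ?thesis
    using entry[of l1 l2] entry[of l2 l1] cmod_eigenvalues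
    by (simp add: eigen_norm_def[of _ _ "f z - p"]) (simp add: eigen_norm_def u_def v_def)
qed

text \<open>
  Errors smaller than \<open>\<eta>\<close> accumulate along a chain to at most the sum \<open>3 * \<eta> / (1 - \<theta>)\<close> of a
  geometric series, which for small \<open>\<eta>\<close> keeps the chain in the region of contraction.
\<close>

lemma N_pseudo_orbit_le:
  assumes contr: "\<And>z. N (z - p) \<le> R \<Longrightarrow> N (f z - p) \<le> \<theta> * N (z - p)"
    and \<theta>: "0 \<le> \<theta>" "\<theta> < 1"
    and \<eta>: "3 * \<eta> / (1 - \<theta>) \<le> (1 - \<theta>) * R"
    and "(x, y) \<in> (pseudo_step f \<eta>)\<^sup>+" "N (x - p) \<le> R"
  shows "N (y - p) \<le> \<theta> * N (x - p) + 3 * \<eta> / (1 - \<theta>)"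
proof -
  have one_step: "N (z - p) \<le> \<theta> * N (y - p) + 3 * \<eta>"
    if "(y, z) \<in> pseudo_step f \<eta>" "N (y - p) \<le> R" for y z
  proof -
    have "N (z - p) \<le> N (f y - p) + N (z - f y)"
      using eigen_norm_triangle[of l1 l2 "f y - p" "z - f y"] by simp
    moreover have "N (z - f y) \<le> 3 * \<eta>"
      using N_le_infnorm[of "z - f y"] that(1) by (auto simp: pseudo_step_def infnorm_sub)
    ultimately show ?thesis
      using contr[OF that(2)] by linarith
  qed
  have sum: "\<theta> * (3 * \<eta> / (1 - \<theta>)) + 3 * \<eta> = 3 * \<eta> / (1 - \<theta>)"
    using \<theta>(2) by (simp add: field_simps)
  have nn: "0 \<le> \<theta> * N w" for w
    using \<theta>(1) eigen_norm_nonneg by simp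
  obtain w where "infnorm (f x - w) < \<eta>"
    using tranclD[OF assms(5)] by (auto simp: pseudo_step_def)
  then have "0 \<le> \<eta>"
    using infnorm_pos_le[of "f x - w"] by linarith
  then have pos: "3 * \<eta> \<le> 3 * \<eta> / (1 - \<theta>)"
    using \<theta> by (simp add: field_simps)
  show ?thesis
    using assms(5)
  proof (induction rule: trancl_induct)
    case (base y)
    then show ?case
      using one_step[OF base assms(6)] pos by linarith
  next
    case (step y z)
    have "\<theta> * N (x - p) \<le> \<theta> * R"
      using assms(6) \<theta>(1) by (rule mult_left_mono)
    then have "N (y - p) \<le> \<theta> * R + (1 - \<theta>) * R"
      using step.IH \<eta> by linarith
    then have "N (y - p) \<le> R"
      by (simp add: algebra_simps)
    then have "N (z - p) \<le> \<theta> * N (y - p) + 3 * \<eta>"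
      using one_step step.hyps(2) by blast
    also have "\<theta> * N (y - p) \<le> \<theta> * (\<theta> * N (x - p) + 3 * \<eta> / (1 - \<theta>))"
      using step.IH \<theta>(1) by (rule mult_left_mono)
    also have "\<dots> = \<theta> * (\<theta> * N (x - p)) + \<theta> * (3 * \<eta> / (1 - \<theta>))"
      by (rule distrib_left)
    also have "\<theta> * (\<theta> * N (x - p)) \<le> 1 * (\<theta> * N (x - p))"
      using \<theta>(2) nn by (intro mult_right_mono) auto
    finally show ?case
      using sum by linarith
  qed
qed

text \<open>
  Two cases matter: \<open>z = q\<close>, where \<open>q\<close> is chain recurrent near the sink, and \<open>z = p\<close>, where chains
  lead from the sink to \<open>q\<close>.
\<close>

lemma eq_sink_if_chains:
  assumes contr: "\<And>z. N (z - p) \<le> R \<Longrightarrow> N (f z - p) \<le> \<theta> * N (z - p)"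
    and \<theta>: "0 \<le> \<theta>" "\<theta> < 1" and "R > 0"
    and chains: "\<And>\<eta>. \<eta> > 0 \<Longrightarrow> (z, q) \<in> (pseudo_step f \<eta>)\<^sup>+"
    and z: "N (z - p) \<le> R" "N (z - p) \<le> N (q - p)"
  shows "q = p"
proof -
  have "(1 - \<theta>) * N (q - p) \<le> 0"
  proof (rule field_le_epsilon)
    fix e :: real assume "e > 0"
    define \<eta> where "\<eta> = (1 - \<theta>) / 3 * min e ((1 - \<theta>) * R)"
    have \<eta>: "\<eta> > 0" "3 * \<eta> / (1 - \<theta>) = min e ((1 - \<theta>) * R)"
      using \<open>e > 0\<close> \<open>R > 0\<close> \<theta>(2) by (simp_all add: \<eta>_def)
    have "N (q - p) \<le> \<theta> * N (z - p) + 3 * \<eta> / (1 - \<theta>)"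
      using \<eta>(2) by (intro N_pseudo_orbit_le[OF contr \<theta> _ chains[OF \<eta>(1)] z(1)]) auto
    moreover have "\<theta> * N (z - p) \<le> \<theta> * N (q - p)"
      using z(2) \<theta>(1) by (rule mult_left_mono)
    ultimately have "N (q - p) \<le> \<theta> * N (q - p) + e"
      unfolding \<eta>(2) by linarith
    then show "(1 - \<theta>) * N (q - p) \<le> 0 + e"
      by (simp add: algebra_simps)
  qed
  then have "N (q - p) \<le> 0"
    using \<theta>(2) by (simp add: mult_le_0_iff)
  then show ?thesis
    using eigen_norm_eq_0[OF distinct] by fastforce
qed

text \<open>
  At the radius \<open>(1 - lam) / g\<^sup>2\<close> the quadratic term cancels the linear contraction. Three quarters
  of it leave room for the ball of half this radius in which the centers of boxes will be trapped,
  and for the boxes around these centers.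
\<close>

lemma contraction:
  assumes "N (z - p) \<le> 3 / 4 * ((1 - lam) / g\<^sup>2)"
  shows "N (f z - p) \<le> (lam + 3 / 4 * (1 - lam)) * N (z - p)"
proof -
  have "g\<^sup>2 * N (z - p) \<le> 3 / 4 * (1 - lam)"
    using assms g_ge_1 by (simp add: field_simps)
  then have "g\<^sup>2 * N (z - p) * N (z - p) \<le> 3 / 4 * (1 - lam) * N (z - p)"
    by (rule mult_right_mono) (rule eigen_norm_nonneg)
  moreover have "(g * N (z - p))\<^sup>2 = g\<^sup>2 * N (z - p) * N (z - p)"
    by (simp add: power2_eq_square)
  ultimately show ?thesis
    using N_henon_le[of z] by (simp add: distrib_right)
qed

lemma eq_sink_if_chains_near:
  assumes "\<And>\<eta>. \<eta> > 0 \<Longrightarrow> (z, q) \<in> (pseudo_step f \<eta>)\<^sup>+"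
    and "N (z - p) \<le> 3 / 4 * ((1 - lam) / g\<^sup>2)" "N (z - p) \<le> N (q - p)"
  shows "q = p"
proof (rule eq_sink_if_chains[OF contraction _ _ _ assms])
  show "0 \<le> lam + 3 / 4 * (1 - lam)" "lam + 3 / 4 * (1 - lam) < 1"
    using lam_less_1 cmod_eigenvalues(5) by argo+
  show "0 < 3 / 4 * ((1 - lam) / g\<^sup>2)"
    using lam_less_1 g_ge_1 by simp
qed


lemma sink_chain_component: "{p} \<in> chain_components f"
proof -
  have "q = p" if "(p, q) \<in> chain_equiv f" for q
    using lam_less_1 chain_equiv_imp_trancl[OF that] eigen_norm_nonneg[of l1 l2 "q - p"]
    by (intro eq_sink_if_chains_near[of p]) (auto simp: eigen_norm_def[of _ _ 0])
  moreover have "p \<in> chain_recurrent f" "(p, p) \<in> chain_equiv f"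
    using fixed fixed_point_chain_recurrent chain_equiv_refl by blast+
  ultimately show ?thesis
    unfolding chain_components_def by (intro quotientI[THEN back_subst[where P = "\<lambda>T. T \<in> _"]]) auto
qed


section \<open>Boxes near the sink\<close>

lemma infnorm_henon_diff_le:
  assumes "infnorm (z - z0) \<le> \<epsilon> / 2"
  shows "infnorm (f z - f z0) \<le>
    max (\<epsilon> / 2) (3 / 4 * (2 * cmod (fst z0) + cmod a) * \<epsilon> + 9 / 16 * \<epsilon>\<^sup>2)"
proof -
  define h k where "h = fst (z - z0)" and "k = snd (z - z0)"
  have hk: "cmod h \<le> 3 / 4 * \<epsilon>" "cmod k \<le> 3 / 4 * \<epsilon>"
    using cmod_fst_le_infnorm[of "z - z0"] cmod_snd_le_infnorm[of "z - z0"] assms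
    unfolding h_def k_def by argo+
  have fst_f: "fst (f z - f z0) = 2 * fst z0 * h + h\<^sup>2 - a * k"
    by (simp add: henon_def split_beta h_def k_def power2_eq_square algebra_simps)
  have "cmod (fst (f z - f z0)) \<le> cmod (2 * fst z0 * h) + cmod (h\<^sup>2) + cmod (a * k)"
    using norm_triangle_ineq4[of "2 * fst z0 * h + h\<^sup>2" "a * k"]
      norm_triangle_ineq[of "2 * fst z0 * h" "h\<^sup>2"] unfolding fst_f by linarith
  also have "\<dots> = 2 * cmod (fst z0) * cmod h + (cmod h)\<^sup>2 + cmod a * cmod k"
    by (simp add: norm_mult norm_power)
  also have "\<dots> \<le> 2 * cmod (fst z0) * (3 / 4 * \<epsilon>) + (3 / 4 * \<epsilon>)\<^sup>2 + cmod a * (3 / 4 * \<epsilon>)"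
    using hk by (intro add_mono mult_left_mono power_mono) auto
  also have "\<dots> = 3 / 4 * (2 * cmod (fst z0) + cmod a) * \<epsilon> + 9 / 16 * \<epsilon>\<^sup>2"
    by (simp add: power2_eq_square algebra_simps)
  finally have bound: "cmod (fst (f z - f z0)) \<le>
      3 / 4 * (2 * cmod (fst z0) + cmod a) * \<epsilon> + 9 / 16 * \<epsilon>\<^sup>2" .
  have fst_le: "max \<bar>Re (fst (f z - f z0))\<bar> \<bar>Im (fst (f z - f z0))\<bar> \<le>
      3 / 4 * (2 * cmod (fst z0) + cmod a) * \<epsilon> + 9 / 16 * \<epsilon>\<^sup>2"
    by (intro max.boundedI order_trans[OF abs_Re_le_cmod bound] order_trans[OF abs_Im_le_cmod bound])
  have snd_le: "max \<bar>Re h\<bar> \<bar>Im h\<bar> \<le> \<epsilon> / 2"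
    using assms unfolding infnorm_C2 h_def by (rule order_trans[OF max.cobounded1])
  have "snd (f z - f z0) = h"
    by (simp add: h_def henon_def split_beta)
  then show ?thesis
    unfolding infnorm_C2
    using max.boundedI[OF max.coboundedI2[OF fst_le] max.coboundedI1[OF snd_le]] by simp
qed

text \<open>
  The hull is contained in every closed box that contains the image, so passing from the image to
  its hull does not worsen the bound.
\<close>

lemma infnorm_center_le:
  assumes image: "\<And>z. z \<in> closed_box z0 \<epsilon> \<Longrightarrow> infnorm (f z - f z0) \<le> \<rho>"
    and "box_hull (f ` closed_box z0 \<epsilon>) \<inter> nbhd (closed_box z1 \<epsilon>) \<delta> \<noteq> {}"
  shows "infnorm (z1 - f z0) \<le> \<rho> + \<delta> + \<epsilon> / 2"
proof -
  obtain w s where w: "w \<in> box_hull (f ` closed_box z0 \<epsilon>)" "infnorm (w - s) < \<delta>"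
    "s \<in> closed_box z1 \<epsilon>"
    using assms(2) by (auto simp: nbhd_def)
  have "f ` closed_box z0 \<epsilon> \<subseteq> closed_box (f z0) (2 * \<rho>)"
    using image by (auto simp: closed_box_def)
  then have "w \<in> closed_box (f z0) (2 * \<rho>)"
    using w(1) box_hull_subset_closed_box by blast
  then have "infnorm (w - f z0) \<le> \<rho>" "infnorm (s - z1) \<le> \<epsilon> / 2"
    using w(3) by (auto simp: closed_box_def)
  then show ?thesis
    using infnorm_triangle_sub[of z1 "f z0" s] infnorm_triangle_sub[of s "f z0" w] w(2)
    by (simp add: infnorm_sub)
qed

text \<open>
  The quantity \<open>\<tau>\<close> is the inverse square of a bound on the condition number of the eigenbasis in
  Euclidean norm. For the larger of the moduli of the eigencoordinates the corresponding constant is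
  \<open>1 / g\<^sup>2\<close>, which is larger by a factor of at least 4. This factor pays for comparing moduli with
  the box norm and for the size of the hulls.
\<close>

lemma four_tau_le:
  "4 * ((cmod (l1 - l2))\<^sup>2 / ((2 + cmod l1 + cmod l2) * (2 + lam\<^sup>2 + cmod a))) \<le> 1 / g\<^sup>2"
proof -
  define x y where "x = cmod l1" and "y = cmod l2"
  have xy: "0 \<le> x" "0 \<le> y" "x < 1" "y < 1" "lam = max x y" "cmod a = x * y"
    using lam_less_1 prod_eigenvalues by (auto simp: x_def y_def lam_eq norm_mult)
  (* For \<open>t \<le> s\<close> the difference of the two sides is at least \<open>2 * (1 - s)\<^sup>2\<close>. *)
  have *: "2 * (s + t) \<le> 2 + s\<^sup>2 + s * t" if "0 \<le> t" "t \<le> s" "s < 1" for s t :: real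
  proof -
    have "t * (2 - s) \<le> s * (2 - s)"
      using that by (intro mult_right_mono) auto
    then show ?thesis
      using zero_le_power2[of "1 - s"] by (simp add: power2_eq_square algebra_simps)
  qed
  have "2 * (x + y) \<le> 2 + lam\<^sup>2 + cmod a"
    using *[of y x] *[of x y] xy by (cases "y \<le> x") (auto simp: max_def algebra_simps)
  moreover have "2 * (x + y) \<le> 2 + x + y"
    using xy(3,4) by argo
  ultimately have "(2 * (x + y)) * (2 * (x + y)) \<le> (2 + x + y) * (2 + lam\<^sup>2 + cmod a)"
    using xy by (intro mult_mono) auto
  moreover have "(2 * (x + y)) * (2 * (x + y)) = 4 * (x + y)\<^sup>2"
    by (simp add: power2_eq_square algebra_simps)
  ultimately have "4 * (x + y)\<^sup>2 \<le> (2 + x + y) * (2 + lam\<^sup>2 + cmod a)"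
    by simp
  moreover have "0 < (x + y)\<^sup>2"
    using g_ge_1 by (auto simp: g_def x_def y_def)
  ultimately have "(cmod (l1 - l2))\<^sup>2 / ((2 + x + y) * (2 + lam\<^sup>2 + cmod a)) \<le>
      (cmod (l1 - l2))\<^sup>2 / (4 * (x + y)\<^sup>2)"
    using xy(1,2) by (intro divide_left_mono mult_pos_pos) (auto intro!: add_pos_nonneg)
  then show ?thesis
    by (simp add: g_def x_def y_def power_divide)
qed

end

text \<open>
  The last assumption is what the bound on \<open>\<epsilon>\<close> becomes once the square root is removed, \<open>\<kappa>\<close> is
  replaced by a lower bound, and \<open>\<tau>\<close> by its upper bound \<open>1 / (4 * g\<^sup>2)\<close>.
\<close>

locale small_boxes = henon_sink +
  fixes \<epsilon> \<delta> M :: real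
  assumes eps_pos: "\<epsilon> > 0" and M: "M > 0" and delta: "\<delta> < \<epsilon> / M"
    and small: "4 * (\<epsilon>\<^sup>2 + (1 + 1 / M + max 1 (2 * infnorm p + cmod a)) * \<epsilon>) \<le>
      (1 - lam)\<^sup>2 / (4 * g\<^sup>2)"
begin

definition r :: real where "r = (1 - lam) / (2 * g\<^sup>2)"

lemma eps_small: "3 / 2 * \<epsilon> \<le> (1 - lam) / (4 * g\<^sup>2)"
proof -
  let ?k = "1 + 1 / M + max 1 (2 * infnorm p + cmod a)"
  have "?k \<ge> 1"
    using M by (simp add: add_increasing le_max_iff_disj)
  then have "1 * \<epsilon> \<le> ?k * \<epsilon>"
    using eps_pos by (intro mult_right_mono) auto
  then have "3 / 2 * \<epsilon> \<le> 4 * (\<epsilon>\<^sup>2 + ?k * \<epsilon>)"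
    using zero_le_power2[of \<epsilon>] eps_pos by argo
  also have "\<dots> \<le> (1 - lam)\<^sup>2 / (4 * g\<^sup>2)"
    by (rule small)
  also have "\<dots> \<le> (1 - lam) / (4 * g\<^sup>2)"
    using lam_less_1 cmod_eigenvalues(5)
    by (intro divide_right_mono) (auto simp: power2_eq_square mult_left_le)
  finally show ?thesis .
qed

lemma near_center:
  assumes "z \<in> closed_box z0 \<epsilon>"
  shows "N (z - z0) \<le> (1 - lam) / (4 * g\<^sup>2)" "N (z0 - z) \<le> (1 - lam) / (4 * g\<^sup>2)"
proof -
  have "infnorm (z - z0) \<le> \<epsilon> / 2" "infnorm (z0 - z) \<le> \<epsilon> / 2"
    using assms by (auto simp: closed_box_def infnorm_sub)
  then show "N (z - z0) \<le> (1 - lam) / (4 * g\<^sup>2)" "N (z0 - z) \<le> (1 - lam) / (4 * g\<^sup>2)"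
    using eps_small N_le_infnorm[of "z - z0"] N_le_infnorm[of "z0 - z"] by linarith+
qed

lemma center_near_sink:
  assumes "p \<in> closed_box z0 \<epsilon>"
  shows "N (z0 - p) \<le> r"
proof -
  have "(1 - lam) / (4 * g\<^sup>2) \<le> r"
    unfolding r_def using lam_less_1 g_ge_1 by (intro divide_left_mono) auto
  with near_center(2)[OF assms] show ?thesis
    by linarith
qed

lemma point_near_sink:
  assumes "z \<in> closed_box z0 \<epsilon>" "N (z0 - p) \<le> r"
  shows "N (z - p) \<le> 3 / 4 * ((1 - lam) / g\<^sup>2)"
proof -
  have "N (z - p) \<le> N (z - z0) + N (z0 - p)"
    using eigen_norm_triangle[of l1 l2 "z - z0" "z0 - p"] by simp
  also have "\<dots> \<le> (1 - lam) / (4 * g\<^sup>2) + (1 - lam) / (2 * g\<^sup>2)"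
    using near_center(1)[OF assms(1)] assms(2) unfolding r_def by (rule add_mono)
  also have "\<dots> = 3 / 4 * ((1 - lam) / g\<^sup>2)"
    using g_ge_1 by (simp add: field_simps)
  finally show ?thesis .
qed

text \<open>
  The function \<open>x - (lam * x + (g * x)\<^sup>2)\<close> has its maximum \<open>(1 - lam)\<^sup>2 / (4 * g\<^sup>2)\<close> at \<open>x = r\<close>.
  So \<open>r\<close> is the radius of the ball that tolerates the largest error per step.
\<close>

lemma center_step:
  assumes z0: "N (z0 - p) \<le> r"
    and hit: "box_hull (f ` closed_box z0 \<epsilon>) \<inter> nbhd (closed_box z1 \<epsilon>) \<delta> \<noteq> {}"
  shows "N (z1 - p) \<le> r"
proof -
  have g: "g > 0"
    using g_ge_1 by linarith
  define \<rho> where "\<rho> = max (\<epsilon> / 2) (3 / 4 * (3 * infnorm p + 1 + cmod a) * \<epsilon> + 9 / 16 * \<epsilon>\<^sup>2)"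
  have "g * N (z0 - p) \<le> g * r"
    using z0 g by (intro mult_left_mono) auto
  moreover have "g * r = (1 - lam) / (2 * g)"
    using g by (simp add: r_def power2_eq_square)
  moreover have "(1 - lam) / (2 * g) \<le> 1 / 2"
    using g_ge_1 cmod_eigenvalues(5) by (simp add: field_simps)
  ultimately have "cmod (fst (z0 - p)) \<le> 1 / 2"
    using cmod_fst_le_g[of "z0 - p"] by linarith
  then have "2 * cmod (fst z0) \<le> 3 * infnorm p + 1"
    using norm_triangle_ineq[of "fst z0 - fst p" "fst p"] cmod_fst_le_infnorm[of p] by simp
  then have "3 / 4 * (2 * cmod (fst z0) + cmod a) * \<epsilon> \<le> 3 / 4 * (3 * infnorm p + 1 + cmod a) * \<epsilon>"
    using eps_pos by (intro mult_right_mono) auto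
  then have "infnorm (f z - f z0) \<le> \<rho>" if "z \<in> closed_box z0 \<epsilon>" for z
    using infnorm_henon_diff_le[of z z0 \<epsilon>] that by (simp add: \<rho>_def closed_box_def)
  then have "infnorm (z1 - f z0) \<le> \<rho> + \<delta> + \<epsilon> / 2"
    using hit by (rule infnorm_center_le)
  then have "N (z1 - f z0) \<le> 3 * (\<rho> + \<delta> + \<epsilon> / 2)"
    using N_le_infnorm[of "z1 - f z0"] by argo
  also have "\<dots> \<le> 4 * (\<epsilon>\<^sup>2 + (1 + 1 / M + max 1 (2 * infnorm p + cmod a)) * \<epsilon>)"
  proof -
    define K where "K = max 1 (2 * infnorm p + cmod a)"
    have K: "K * \<epsilon> \<ge> \<epsilon>" "K * \<epsilon> \<ge> 2 * (infnorm p * \<epsilon>) + cmod a * \<epsilon>"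
    proof -
      have "1 * \<epsilon> \<le> K * \<epsilon>" "(2 * infnorm p + cmod a) * \<epsilon> \<le> K * \<epsilon>"
        unfolding K_def using eps_pos by (intro mult_right_mono; simp)+
      then show "K * \<epsilon> \<ge> \<epsilon>" "K * \<epsilon> \<ge> 2 * (infnorm p * \<epsilon>) + cmod a * \<epsilon>"
        by (auto simp: algebra_simps)
    qed
    have nn: "0 \<le> infnorm p * \<epsilon>" "0 \<le> cmod a * \<epsilon>" "0 \<le> \<epsilon>\<^sup>2" "0 < \<epsilon> / M"
      using eps_pos M by (auto simp: infnorm_pos_le)
    have "\<rho> = max (\<epsilon> / 2) (9 / 4 * (infnorm p * \<epsilon>) + 3 / 4 * \<epsilon> + 3 / 4 * (cmod a * \<epsilon>) + 9 / 16 * \<epsilon>\<^sup>2)"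
      by (simp add: \<rho>_def algebra_simps)
    (* After multiplication by 3, the second entry has the coefficients 27/4 of infnorm p and 9/4 of
       cmod a; they are covered by the coefficients 8 and 4 in 4 * K, and 15/4 * \<epsilon> by 4 * \<epsilon>. *)
    also have "\<dots> \<le> 4 / 3 * (\<epsilon>\<^sup>2 + \<epsilon> + \<epsilon> / M + K * \<epsilon>) - \<delta> - \<epsilon> / 2"
      using K nn delta eps_pos by (intro max.boundedI) argo+
    finally have "3 * (\<rho> + \<delta> + \<epsilon> / 2) \<le> 4 * (\<epsilon>\<^sup>2 + \<epsilon> + \<epsilon> / M + K * \<epsilon>)"
      by argo
    then show ?thesis
      by (simp add: K_def algebra_simps)
  qed
  also note small
  finally have error: "N (z1 - f z0) \<le> (1 - lam)\<^sup>2 / (4 * g\<^sup>2)" .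
  have "N (z1 - p) \<le> N (z1 - f z0) + N (f z0 - p)"
    using eigen_norm_triangle[of l1 l2 "z1 - f z0" "f z0 - p"] by simp
  also have "\<dots> \<le> (1 - lam)\<^sup>2 / (4 * g\<^sup>2) + (lam * N (z0 - p) + (g * N (z0 - p))\<^sup>2)"
    using error N_henon_le by (rule add_mono)
  also have "\<dots> \<le> (1 - lam)\<^sup>2 / (4 * g\<^sup>2) + (lam * r + (g * r)\<^sup>2)"
    using z0 g cmod_eigenvalues(5) eigen_norm_nonneg
    by (intro add_left_mono add_mono mult_left_mono power_mono) auto
  also have "\<dots> = r"
    using g by (simp add: r_def power2_eq_square field_simps)
  finally show ?thesis .
qed

lemma box_chain_near_sink:
  assumes "box_chain_model f \<epsilon> \<delta> \<Gamma>" "p \<in> B" "B \<in> pverts \<Gamma>" "(B, B') \<in> (parcs \<Gamma>)\<^sup>*"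
  shows "\<exists>z0. B' = closed_box z0 \<epsilon> \<and> N (z0 - p) \<le> r"
proof -
  obtain W where W: "\<And>B. B \<in> W \<Longrightarrow> \<exists>z0. B = closed_box z0 \<epsilon>"
    and \<Gamma>: "\<Gamma> = cyclic_part (transition_graph f W \<delta>)"
    using box_chain_modelE[OF assms(1)] by metis
  show ?thesis
    using assms(4)
  proof (induction rule: rtrancl_induct)
    case base
    have "B \<in> W"
      using assms(3) verts_cyclic_transition_subset unfolding \<Gamma> by blast
    then show ?case
      using W center_near_sink assms(2) by metis
  next
    case (step C D)
    then obtain z0 where z0: "C = closed_box z0 \<epsilon>" "N (z0 - p) \<le> r"
      by blast
    have "D \<in> W" "box_hull (f ` C) \<inter> nbhd D \<delta> \<noteq> {}"
      using step.hyps(2) unfolding \<Gamma> arcs_cyclic_part[OF pair_wf_digraph_transition_graph]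
      by (auto simp: transition_graph_def)
    then show ?case
      using W center_step z0 by metis
  qed
qed

text \<open>
  All boxes of the strong component of the sink can be reached from a box that contains the sink,
  so they lie in the region of contraction, where the sink is the only chain recurrent point.
\<close>

lemma component_in_scc_of_sink:
  assumes "box_chain_model f \<epsilon> \<delta> \<Gamma>" "H \<in> pre_digraph.sccs (with_proj \<Gamma>)"
    and "lies_in {p} H" "lies_in T H" "T \<in> chain_components f"
  shows "T = {p}"
proof -
  obtain W where \<Gamma>: "\<Gamma> = cyclic_part (transition_graph f W \<delta>)"
    using box_chain_modelE[OF assms(1)] by metis
  interpret \<Gamma>: pair_wf_digraph \<Gamma>
    unfolding \<Gamma> by (rule pair_wf_digraph_cyclic_part[OF pair_wf_digraph_transition_graph])
  obtain B where B: "p \<in> B" "B \<in> verts H"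
    using assms(3) by (auto simp: lies_in_def)
  have "verts H \<subseteq> pverts \<Gamma>"
    using assms(2) by (intro \<Gamma>.sccs_verts_subsets \<Gamma>.in_sccs_vertsI_sccs) blast
  then have "B \<in> pverts \<Gamma>"
    using B(2) by blast
  have "q = p" if q: "q \<in> T" for q
  proof -
    obtain B' where B': "q \<in> B'" "B' \<in> verts H"
      using assms(4) q by (auto simp: lies_in_def)
    have "(B, B') \<in> (parcs \<Gamma>)\<^sup>*"
      using scc_imp_rtrancl[OF assms(1,2) B(2) B'(2)] .
    then obtain z0 where "B' = closed_box z0 \<epsilon>" "N (z0 - p) \<le> r"
      using box_chain_near_sink[OF assms(1) B(1) \<open>B \<in> pverts \<Gamma>\<close>] by blast
    then have "N (q - p) \<le> 3 / 4 * ((1 - lam) / g\<^sup>2)"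
      using point_near_sink B'(1) by blast
    then show ?thesis
      using chain_component_imp_trancl[OF assms(5) q q] by (intro eq_sink_if_chains_near[of q]) auto
  qed
  then show ?thesis
    using chain_component_nonempty[OF assms(5)] by blast
qed

lemma separates_sink:
  assumes "box_chain_model f \<epsilon> \<delta> \<Gamma>" "T \<in> chain_components f" "T \<noteq> {p}"
  shows "separates f \<Gamma> {p} T"
proof -
  obtain H where H: "H \<in> pre_digraph.sccs (with_proj \<Gamma>)" "lies_in {p} H"
    using component_lies_in_scc[OF assms(1) sink_chain_component] by blast
  obtain H' where H': "H' \<in> pre_digraph.sccs (with_proj \<Gamma>)" "lies_in T H'"
    using component_lies_in_scc[OF assms(1,2)] by blast
  have "H \<noteq> H'"
    using component_in_scc_of_sink[OF assms(1) H _ assms(2)] H'(2) assms(3) by blast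
  then show ?thesis
    unfolding separates_def using H H' assms(2) sink_chain_component by blast
qed

end


section \<open>The bound on the box size\<close>

lemma quadratic_from_sqrt_bound:
  fixes \<epsilon> \<kappa> t :: real
  assumes "0 \<le> \<epsilon>" "0 \<le> \<kappa>" "0 \<le> t" "\<epsilon> < 1 / 2 * (- \<kappa> + sqrt (\<kappa>\<^sup>2 + t))"
  shows "4 * (\<epsilon>\<^sup>2 + \<kappa> * \<epsilon>) < t"
proof -
  have "2 * \<epsilon> + \<kappa> < sqrt (\<kappa>\<^sup>2 + t)"
    using assms(4) by argo
  then have "(2 * \<epsilon> + \<kappa>)\<^sup>2 < (sqrt (\<kappa>\<^sup>2 + t))\<^sup>2"
    using assms(1,2) by (intro power_strict_mono) auto
  also have "\<dots> = \<kappa>\<^sup>2 + t"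
    using assms(3) by simp
  finally show ?thesis
    by (simp add: power2_eq_square algebra_simps)
qed


theorem theorem1p6:
  fixes a c lam1 lam2 :: complex and p :: C2 and f :: "C2 \<Rightarrow> C2"
    and lam \<tau> \<kappa> \<epsilon> \<delta> M :: real and \<Gamma> :: "C2 set pair_pre_digraph"
  assumes "f = henon a c" and "a \<noteq> 0"
    and "attracting_fixed_point f p"
    and "eigenvals (frechet_derivative f (at p)) = {lam1, lam2}" and "lam1 \<noteq> lam2"
    and "lam = max (cmod lam1) (cmod lam2)"
    and "\<tau> = (cmod (lam1 - lam2))\<^sup>2 /
               ((2 + cmod lam1 + cmod lam2) * (2 + lam\<^sup>2 + cmod a))"
    and "box_chain_model f \<epsilon> \<delta> \<Gamma>"
    and "M > 1" and "\<delta> < \<epsilon> / M"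
    and "\<kappa> = 1 + 1 / M + max 1 ((1 - lam) * sqrt \<tau> + 2 * infnorm p + cmod a)"
    and "\<epsilon> < 1 / 2 * (- \<kappa> + sqrt (\<kappa>\<^sup>2 + \<tau> * (1 - lam)\<^sup>2))"
  shows "\<forall>T \<in> chain_components f. T \<noteq> {p} \<longrightarrow> separates f \<Gamma> {p} T"
proof -
  have p: "henon a c p = p" and attr: "\<forall>\<mu>\<in>{lam1, lam2}. cmod \<mu> < 1"
    using assms(1,3,4) by (auto simp: attracting_fixed_point_def)
  have "lam1 + lam2 = 2 * fst p" "lam1 * lam2 = a"
    using eigenvals_henon_vieta assms(1,4,5) by blast+
  then interpret henon_sink a c lam1 lam2 p lam
    using p attr assms(5,6) by unfold_locales auto
  have "\<epsilon> > 0"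
    using box_chain_modelE[OF assms(8)] by blast
  define \<kappa>' where "\<kappa>' = 1 + 1 / M + max 1 (2 * infnorm p + cmod a)"
  have "0 \<le> \<tau>"
    unfolding assms(7) using lam_less_1 by (intro divide_nonneg_nonneg mult_nonneg_nonneg) auto
  then have "0 \<le> (1 - lam) * sqrt \<tau>"
    using lam_less_1 by simp
  then have "\<kappa>' \<le> \<kappa>"
    unfolding \<kappa>'_def assms(11) by (intro add_left_mono max.mono) auto
  moreover have "0 \<le> \<kappa>'"
    unfolding \<kappa>'_def using assms(9) by (intro add_nonneg_nonneg) auto
  ultimately have "4 * (\<epsilon>\<^sup>2 + \<kappa>' * \<epsilon>) \<le> 4 * (\<epsilon>\<^sup>2 + \<kappa> * \<epsilon>)"
    using \<open>\<epsilon> > 0\<close> by (intro mult_left_mono add_left_mono mult_right_mono) auto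
  also have "\<dots> \<le> \<tau> * (1 - lam)\<^sup>2"
    using \<open>\<epsilon> > 0\<close> \<open>0 \<le> \<kappa>'\<close> \<open>\<kappa>' \<le> \<kappa>\<close> \<open>0 \<le> \<tau>\<close> assms(12)
    by (intro order.strict_implies_order[OF quadratic_from_sqrt_bound]) auto
  also have "\<dots> \<le> (1 / g\<^sup>2 / 4) * (1 - lam)\<^sup>2"
    using four_tau_le unfolding assms(7)[symmetric] by (intro mult_right_mono) auto
  finally interpret small_boxes a c lam1 lam2 p lam \<epsilon> \<delta> M
    using \<open>\<epsilon> > 0\<close> assms(9,10) by unfold_locales (auto simp: \<kappa>'_def mult.commute)
  show ?thesis
    using separates_sink assms(1,8) by blast
qed

end
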